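(* Suppose that $\pi_\Psi$ is positive and continuous, that we have a regular discretization $\{B_\lambda(\psi):\psi\in\Psi\}$, $\lambda>0$, of $\Psi$, and that $\pi_\Psi(\psi\,|\,x)/\pi_\Psi(\psi)$ has a continuous posterior distribution (i.e. its distribution under $\psi\sim\Pi_\Psi(\cdot\,|\,x)$ has no atoms). Then $$C_\gamma(x)=\lim_{\lambda\to0}\,\liminf_{\eta\to0}\,L_{\eta,\lambda,\gamma}(x)=\lim_{\lambda\to0}\,\limsup_{\eta\to0}\,L_{\eta,\lambda,\gamma}(x).$$
   Context: Setting: $\{f_\theta:\theta\in\Theta\}$ is a family of probability densities with respect to a support measure $\mu$ on a sample space $\mathcal X$. $\Pi$ is a proper prior (probability measure) on $\Theta$ with density $\pi$ with respect to a support measure $\nu$. Put $m(x)=\int_\Theta \pi(\theta)f_\theta(x)\,\nu(d\theta)$. The posterior $\Pi(\cdot\,|\,x)$ has density $\pi(\theta)f_\theta(x)/m(x)$ with respect to $\nu$. A map $\Psi:\Theta\to\Psi$ is given; the same symbol $\Psi$ denotes the map and its target space. $\Pi_\Psi$ and $\Pi_\Psi(\cdot\,|\,x)$ are the marginal prior and marginal posterior of $\psi=\Psi(\theta)$, with densities $\pi_\Psi$ and $\pi_\Psi(\cdot\,|\,x)$ with respect to a support measure $\nu_\Psi$ on $\Psi$. All spaces are open subsets of Euclidean spaces, the support measures are Euclidean volume on these sets, and mappings are assumed to be sufficiently smooth. $I(\cdot)$ is the indicator. Here $\gamma\in[0,1]$ is the credibility level. Regular discretization: for each $\lambda>0$,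 $\{B_\lambda(\psi):\psi\in\Psi\}$ is a countable partition of $\Psi$ with $\psi\in B_\lambda(\psi)$ and $\Pi_\Psi(B_\lambda(\psi))>0$ (so $B_\lambda(\psi)$ is the cell containing $\psi$); $\sup_{\psi\in\Psi}\mathrm{diam}(B_\lambda(\psi))\to0$ as $\lambda\to0$; and $\Pi_\Psi(B_\lambda(\psi))/\nu_\Psi(B_\lambda(\psi))\to\pi_\Psi(\psi)$ as $\lambda\to0$ for every $\psi$. One point $\psi_\lambda(\psi)\in B_\lambda(\psi)$ is chosen in each cell, so that $\psi_\lambda(\psi')=\psi_\lambda(\psi)$ whenever $\psi'\in B_\lambda(\psi)$, and $\Psi_\lambda=\{\psi_\lambda(\psi):\psi\in\Psi\}$. The discretized prior and posterior on $\Psi_\lambda$ are $\pi_{\Psi,\lambda}(\psi_\lambda(\psi))=\Pi_\Psi(B_\lambda(\psi))$ and $\pi_{\Psi,\lambda}(\psi_\lambda(\psi)\,|\,x)=\Pi_\Psi(B_\lambda(\psi)\,|\,x)$; write $\Pi_{\Psi,\lambda}(\cdot\,|\,x)$ for the corresponding posterior measure on $\Psi_\lambda$. The $\gamma$-relative surprise region is $C_\gamma(x)=\{\psi\in\Psi:\pi_\Psi(\psi\,|\,x)/\pi_\Psi(\psi)\geq c_\gamma(x)\}$ with $c_\gamma(x)=\sup\{k:\Pi_\Psi(\{\psi:\pi_\Psi(\psi\,|\,x)/\pi_\Psi(\psi)\geq k\}\,|\,x)\geq\gamma\}$. For $\lambda,\eta>0$ the loss function of the discretized problem is $$L_{\lambda,\eta}(\theta,\psi_\lambda(\psi))=\frac{I(\psi_\lambda(\Psi(\theta))\neq\psi_\lambda(\psi))}{\max(\eta,\pi_{\Psi,\lambda}(\psi_\lambda(\Psi(\theta))))}.$$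 $L^*_{\eta,\lambda,\gamma}(x)\subset\Psi_\lambda$ is the $\gamma$-lowest posterior loss region for the discretized problem with this loss (the set of actions in $\Psi_\lambda$ whose posterior risk is at most the smallest cutoff giving posterior content at least $\gamma$), that is, $$L^*_{\eta,\lambda,\gamma}(x)=\{\psi\in\Psi_\lambda:\pi_{\Psi,\lambda}(\psi\,|\,x)/\max(\eta,\pi_{\Psi,\lambda}(\psi))\geq l\},$$ with $l=\sup\{k:\Pi_{\Psi,\lambda}(\{\psi\in\Psi_\lambda:\pi_{\Psi,\lambda}(\psi\,|\,x)/\max(\eta,\pi_{\Psi,\lambda}(\psi))\geq k\}\,|\,x)\geq\gamma\}$. The undiscretized version of $S^*\subset\Psi_\lambda$ is $S=\bigcup_{\psi\in S^*}B_\lambda(\psi)$, and $L_{\eta,\lambda,\gamma}(x)$ is the undiscretized version of $L^*_{\eta,\lambda,\gamma}(x)$. Convention: two subsets of $\Psi$ are considered equal if they differ only by a set of $\Pi_\Psi$-measure $0$. For sets $A_t$ indexed by $t>0$, $\liminf_{t\to0}A_t=\bigcup_{t_0>0}\bigcap_{0<t<t_0}A_t$, $\limsup_{t\to0}A_t=\bigcap_{t_0>0}\bigcup_{0<t<t_0}A_t$, and $\lim_{t\to0}A_t=A$ means that both equal $A$ in the sense of this convention.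
   Formalization: For γ=1 only, the posterior density π_Ψ(·|x) is also assumed positive almost everywhere (the claim fails there otherwise); "sufficiently smooth" is read as: π_Ψ(·|x) is continuous at almost every ψ. *)

theory Defs
  imports "HOL-Probability.Probability"
begin

section \<open>Prior, posterior and their marginals\<close>

text \<open>Euclidean volume on a set.\<close>

abbreviation vol :: "'a::euclidean_space set \<Rightarrow> 'a measure"
  where "vol S \<equiv> restrict_space lborel S"

definition prior :: "'a::euclidean_space set \<Rightarrow> ('a \<Rightarrow> real) \<Rightarrow> 'a measure"
  where "prior \<Theta> \<pi> = density (vol \<Theta>) (\<lambda>\<theta>. ennreal (\<pi> \<theta>))"

text \<open>The Bochner integral of a non-integrable function is 0, so for nonnegative measurable
  integrands \<open>0 < evidence \<Theta> \<pi> f x\<close> says that the integral is positive and finite.\<close>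

definition evidence ::
    "'a::euclidean_space set \<Rightarrow> ('a \<Rightarrow> real) \<Rightarrow> ('a \<Rightarrow> 'x \<Rightarrow> real) \<Rightarrow> 'x \<Rightarrow> real"
  where "evidence \<Theta> \<pi> f x = (LINT \<theta>|vol \<Theta>. \<pi> \<theta> * f \<theta> x)"

definition posterior ::
    "'a::euclidean_space set \<Rightarrow> ('a \<Rightarrow> real) \<Rightarrow> ('a \<Rightarrow> 'x \<Rightarrow> real) \<Rightarrow> 'x \<Rightarrow> 'a measure"
  where "posterior \<Theta> \<pi> f x =
    density (vol \<Theta>) (\<lambda>\<theta>. ennreal (\<pi> \<theta> * f \<theta> x / evidence \<Theta> \<pi> f x))"

text \<open>In what follows \<open>\<Psi>\<close> is the map and \<open>\<Omega>\<close> its target space.\<close>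

definition marginal ::
    "'a measure \<Rightarrow> ('a \<Rightarrow> 'p::euclidean_space) \<Rightarrow> 'p set \<Rightarrow> 'p measure"
  where "marginal M \<Psi> \<Omega> = distr M (vol \<Omega>) \<Psi>"


section \<open>Relative surprise regions\<close>

text \<open>Here \<open>P\<close> is the marginal posterior, \<open>p\<close> its density and \<open>q\<close> the marginal prior density. The
  supremum is taken in the extended reals: it is \<open>\<infinity>\<close> for \<open>\<gamma> = 0\<close>.\<close>

definition surprise_cutoff ::
    "'p set \<Rightarrow> 'p measure \<Rightarrow> ('p \<Rightarrow> real) \<Rightarrow> ('p \<Rightarrow> real) \<Rightarrow> real \<Rightarrow> ereal"
  where "surprise_cutoff \<Omega> P p q \<gamma> =
    Sup (ereal ` {k. measure P {\<psi>\<in>\<Omega>. p \<psi> / q \<psi> \<ge> k} \<ge> \<gamma>})"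

definition surprise_region ::
    "'p set \<Rightarrow> 'p measure \<Rightarrow> ('p \<Rightarrow> real) \<Rightarrow> ('p \<Rightarrow> real) \<Rightarrow> real \<Rightarrow> 'p set"
  where "surprise_region \<Omega> P p q \<gamma> =
    {\<psi>\<in>\<Omega>. ereal (p \<psi> / q \<psi>) \<ge> surprise_cutoff \<Omega> P p q \<gamma>}"


section \<open>Regular discretizations\<close>

text \<open>The library's \<^const>\<open>diameter\<close> is real-valued and unspecified on unbounded sets, which are
  allowed as cells.\<close>

definition ediam :: "'p::metric_space set \<Rightarrow> ennreal"
  where "ediam S = (SUP a\<in>S. SUP b\<in>S. ennreal (dist a b))"

definition regular_discretization ::
    "'p::euclidean_space set \<Rightarrow> 'p measure \<Rightarrow> ('p \<Rightarrow> real) \<Rightarrow> (real \<Rightarrow> 'p \<Rightarrow> 'p set) \<Rightarrow> bool"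
  where "regular_discretization \<Omega> Q q B \<longleftrightarrow>
    (\<forall>l>0. countable (B l ` \<Omega>) \<and> partition_on \<Omega> (B l ` \<Omega>) \<and>
       (\<forall>\<psi>\<in>\<Omega>. \<psi> \<in> B l \<psi> \<and> B l \<psi> \<in> sets Q \<and> measure Q (B l \<psi>) > 0)) \<and>
    ((\<lambda>l. SUP \<psi>\<in>\<Omega>. ediam (B l \<psi>)) \<longlongrightarrow> 0) (at_right 0) \<and>
    (\<forall>\<psi>\<in>\<Omega>. ((\<lambda>l. measure Q (B l \<psi>) / measure (vol \<Omega>) (B l \<psi>)) \<longlongrightarrow> q \<psi>) (at_right 0))"

definition cell_representatives ::
    "'p set \<Rightarrow> (real \<Rightarrow> 'p \<Rightarrow> 'p set) \<Rightarrow> (real \<Rightarrow> 'p \<Rightarrow> 'p) \<Rightarrow> bool"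
  where "cell_representatives \<Omega> B s \<longleftrightarrow>
    (\<forall>l>0. \<forall>\<psi>\<in>\<Omega>. s l \<psi> \<in> B l \<psi> \<and> (\<forall>\<psi>'\<in>B l \<psi>. s l \<psi>' = s l \<psi>))"


section \<open>Lowest posterior loss regions of the discretized problem\<close>

text \<open>From here on \<open>C\<close> and \<open>s\<close> are the cell map and the choice of representatives for one fixed
  discretization parameter. A representative lies in its own cell, so the discretized mass of a
  representative \<open>a\<close> is the mass of \<open>C a\<close>.\<close>

definition disc_mass :: "'p measure \<Rightarrow> ('p \<Rightarrow> 'p set) \<Rightarrow> 'p \<Rightarrow> real"
  where "disc_mass M C a = measure M (C a)"

definition disc_measure :: "'p set \<Rightarrow> 'p measure \<Rightarrow> ('p \<Rightarrow> 'p set) \<Rightarrow> ('p \<Rightarrow> 'p) \<Rightarrow> 'p measure"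
  where "disc_measure \<Omega> M C s = point_measure (s ` \<Omega>) (\<lambda>a. ennreal (disc_mass M C a))"

definition disc_loss ::
    "'p measure \<Rightarrow> ('a \<Rightarrow> 'p) \<Rightarrow> ('p \<Rightarrow> 'p set) \<Rightarrow> ('p \<Rightarrow> 'p) \<Rightarrow> real \<Rightarrow> 'a \<Rightarrow> 'p \<Rightarrow> real"
  where "disc_loss Q \<Psi> C s \<eta> \<theta> a =
    (if s (\<Psi> \<theta>) \<noteq> a then 1 else 0) / max \<eta> (disc_mass Q C (s (\<Psi> \<theta>)))"

definition disc_risk ::
    "'p measure \<Rightarrow> 'a measure \<Rightarrow> ('a \<Rightarrow> 'p) \<Rightarrow> ('p \<Rightarrow> 'p set) \<Rightarrow> ('p \<Rightarrow> 'p) \<Rightarrow> real \<Rightarrow> 'p \<Rightarrow> real"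
  where "disc_risk Q Post \<Psi> C s \<eta> a = (LINT \<theta>|Post. disc_loss Q \<Psi> C s \<eta> \<theta> a)"

text \<open>For a decision problem with action set \<open>A\<close>, posterior content \<open>D\<close> and posterior risk \<open>r\<close>.\<close>

definition lowest_risk_region :: "'p set \<Rightarrow> 'p measure \<Rightarrow> ('p \<Rightarrow> real) \<Rightarrow> real \<Rightarrow> 'p set"
  where "lowest_risk_region A D r \<gamma> =
    {a\<in>A. ereal (r a) \<le> Inf (ereal ` {d. measure D {b\<in>A. r b \<le> d} \<ge> \<gamma>})}"

definition disc_lpl_region ::
    "'p::euclidean_space set \<Rightarrow> 'a measure \<Rightarrow> 'a measure \<Rightarrow> ('a \<Rightarrow> 'p) \<Rightarrow> ('p \<Rightarrow> 'p set) \<Rightarrow>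
     ('p \<Rightarrow> 'p) \<Rightarrow> real \<Rightarrow> real \<Rightarrow> 'p set"
  where "disc_lpl_region \<Omega> Pri Post \<Psi> C s \<eta> \<gamma> =
    lowest_risk_region (s ` \<Omega>) (disc_measure \<Omega> (marginal Post \<Psi> \<Omega>) C s)
      (disc_risk (marginal Pri \<Psi> \<Omega>) Post \<Psi> C s \<eta>) \<gamma>"

definition undiscretize :: "('p \<Rightarrow> 'p set) \<Rightarrow> 'p set \<Rightarrow> 'p set"
  where "undiscretize C S = (\<Union>a\<in>S. C a)"

definition lpl_region ::
    "'p::euclidean_space set \<Rightarrow> 'a measure \<Rightarrow> 'a measure \<Rightarrow> ('a \<Rightarrow> 'p) \<Rightarrow> (real \<Rightarrow> 'p \<Rightarrow> 'p set) \<Rightarrow>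
     (real \<Rightarrow> 'p \<Rightarrow> 'p) \<Rightarrow> real \<Rightarrow> real \<Rightarrow> real \<Rightarrow> 'p set"
  where "lpl_region \<Omega> Pri Post \<Psi> B s \<eta> l \<gamma> =
    undiscretize (B l) (disc_lpl_region \<Omega> Pri Post \<Psi> (B l) (s l) \<eta> \<gamma>)"


section \<open>Limits of sets as the index decreases to 0\<close>

definition liminf0 :: "(real \<Rightarrow> 'p set) \<Rightarrow> 'p set"
  where "liminf0 A = (\<Union>t0\<in>{0<..}. \<Inter>t\<in>{0<..<t0}. A t)"

definition limsup0 :: "(real \<Rightarrow> 'p set) \<Rightarrow> 'p set"
  where "limsup0 A = (\<Inter>t0\<in>{0<..}. \<Union>t\<in>{0<..<t0}. A t)"

text \<open>Formulated with \<^const>\<open>almost_everywhere\<close> because a union or intersection over uncountably many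
  indices need not be measurable.\<close>

definition eq_mod_null :: "'p measure \<Rightarrow> 'p set \<Rightarrow> 'p set \<Rightarrow> bool"
  where "eq_mod_null M S T \<longleftrightarrow> (AE \<psi> in M. \<psi> \<in> S \<longleftrightarrow> \<psi> \<in> T)"

definition set_lim0 :: "'p measure \<Rightarrow> (real \<Rightarrow> 'p set) \<Rightarrow> 'p set \<Rightarrow> bool"
  where "set_lim0 M A S \<longleftrightarrow> eq_mod_null M (liminf0 A) S \<and> eq_mod_null M (limsup0 A) S"


section \<open>The lowest posterior loss region in closed form\<close>

lemma cell_constant_measurable:
  assumes cnt: "countable (C ` \<Omega>)" and part: "partition_on \<Omega> (C ` \<Omega>)"
    and cell: "\<And>\<psi>. \<psi> \<in> \<Omega> \<Longrightarrow> \<psi> \<in> C \<psi> \<and> C \<psi> \<in> sets M" and sp: "space M = \<Omega>"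
    and const: "\<And>\<psi> \<psi>'. \<psi> \<in> \<Omega> \<Longrightarrow> \<psi>' \<in> C \<psi> \<Longrightarrow> h \<psi>' = h \<psi>"
  shows "(h :: 'p \<Rightarrow> real) \<in> borel_measurable M"
proof (rule measurableI)
  fix A :: "real set"
  have sub: "C \<psi> \<subseteq> \<Omega>" if "\<psi> \<in> \<Omega>" for \<psi>
    using partition_onD1[OF part] that by blast
  have "h -` A \<inter> space M = \<Union> {c \<in> C ` \<Omega>. h ` c \<subseteq> A}"
    (is "_ = ?U")
  proof (intro set_eqI iffI)
    fix z assume z: "z \<in> h -` A \<inter> space M"
    hence zo: "z \<in> \<Omega>" by (simp add: sp)
    have "h ` C z \<subseteq> A" using z const[OF zo] by auto
    thus "z \<in> ?U" using zo cell[OF zo] by blast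
  next
    fix z assume "z \<in> ?U"
    then obtain \<psi> where "\<psi> \<in> \<Omega>" "z \<in> C \<psi>" "h ` C \<psi> \<subseteq> A" by blast
    thus "z \<in> h -` A \<inter> space M" using sub sp by blast
  qed
  also have "\<dots> \<in> sets M"
    by (rule sets.countable_Union) (use cnt cell in \<open>auto intro: countable_subset\<close>)
  finally show "h -` A \<inter> space M \<in> sets M" .
qed auto

lemma disc_risk_eq:
  assumes post: "prob_space Post" and meas: "\<Psi> \<in> measurable Post (vol \<Omega>)" and om: "open \<Omega>"
    and cnt: "countable (C ` \<Omega>)" and part: "partition_on \<Omega> (C ` \<Omega>)"
    and cell: "\<And>\<psi>. \<psi> \<in> \<Omega> \<Longrightarrow> \<psi> \<in> C \<psi> \<and> C \<psi> \<in> sets (vol \<Omega>)"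
    and rep: "\<And>\<psi>. \<psi> \<in> \<Omega> \<Longrightarrow> s \<psi> \<in> C \<psi>"
    and rep_const: "\<And>\<psi> \<psi>'. \<psi> \<in> \<Omega> \<Longrightarrow> \<psi>' \<in> C \<psi> \<Longrightarrow> s \<psi>' = s \<psi>"
    and eta: "\<eta> > 0" and a: "a \<in> s ` \<Omega>"
  shows "disc_risk Q Post \<Psi> C s \<eta> a =
    (LINT \<theta>|Post. 1 / max \<eta> (disc_mass Q C (s (\<Psi> \<theta>))))
      - disc_mass (marginal Post \<Psi> \<Omega>) C a / max \<eta> (disc_mass Q C a)"
proof -
  interpret prob_space Post by fact
  have sp: "space (vol \<Omega>) = \<Omega>" by (simp add: space_restrict_space)
  have in_om: "\<Psi> \<theta> \<in> \<Omega>" if "\<theta> \<in> space Post" for \<theta>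
    using measurable_space[OF meas that] sp by simp
  let ?w = "\<lambda>\<psi>. 1 / max \<eta> (disc_mass Q C (s \<psi>))"
  have w: "?w \<in> borel_measurable (vol \<Omega>)"
    by (rule cell_constant_measurable[OF cnt part cell sp]) (simp_all add: rep_const)
  have w': "(\<lambda>\<theta>. ?w (\<Psi> \<theta>)) \<in> borel_measurable Post"
    using measurable_compose[OF meas w] by simp
  have int_w: "integrable Post (\<lambda>\<theta>. ?w (\<Psi> \<theta>))"
    by (rule integrable_const_bound[where B = "1 / \<eta>"])
      (use eta w' in \<open>auto intro!: AE_I2 simp: field_simps\<close>)
  obtain \<psi>0 where p0: "\<psi>0 \<in> \<Omega>" "a = s \<psi>0" using a by auto
  have a_om: "a \<in> \<Omega>"
    using partition_onD1[OF part] rep[OF p0(1)] p0 by blast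
  have same: "C \<psi> = C \<psi>'" if "\<psi> \<in> \<Omega>" "\<psi>' \<in> \<Omega>" "z \<in> C \<psi>" "z \<in> C \<psi>'" for \<psi> \<psi>' z
    using partition_onD2[OF part] that unfolding disjoint_def by blast
  have Ca: "C a = C \<psi>0"
    using same[OF a_om p0(1), of a] cell[OF a_om] rep[OF p0(1)] p0(2) by simp
  have iff: "s \<psi> = a \<longleftrightarrow> \<psi> \<in> C a" if "\<psi> \<in> \<Omega>" for \<psi>
  proof
    assume "s \<psi> = a"
    hence "C \<psi> = C a" using same[OF that a_om, of a] rep[OF that] cell[OF a_om] by simp
    thus "\<psi> \<in> C a" using cell[OF that] by simp
  next
    assume "\<psi> \<in> C a"
    thus "s \<psi> = a" using rep_const[OF p0(1), of \<psi>] Ca p0(2) by simp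
  qed
  let ?E = "\<Psi> -` C a \<inter> space Post"
  have E: "?E \<in> sets Post" using measurable_sets[OF meas] cell[OF a_om] by blast
  have int_E: "integrable Post (\<lambda>\<theta>. indicator ?E \<theta> / max \<eta> (disc_mass Q C a))"
    by (intro integrable_divide_zero integrable_real_indicator E) (simp add: emeasure_eq_measure)
  have "disc_risk Q Post \<Psi> C s \<eta> a =
      (LINT \<theta>|Post. ?w (\<Psi> \<theta>) - indicator ?E \<theta> / max \<eta> (disc_mass Q C a))"
    unfolding disc_risk_def disc_loss_def
    by (rule Bochner_Integration.integral_cong)
      (use iff[OF in_om] in \<open>auto simp: indicator_def\<close>)
  also have "\<dots> = (LINT \<theta>|Post. ?w (\<Psi> \<theta>)) - measure Post ?E / max \<eta> (disc_mass Q C a)"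
    using Bochner_Integration.integral_diff[OF int_w int_E] by simp
  also have "measure Post ?E = disc_mass (marginal Post \<Psi> \<Omega>) C a"
    unfolding disc_mass_def marginal_def using measure_distr[OF meas] cell[OF a_om] by simp
  finally show ?thesis .
qed

lemma disc_lpl_region_eq:
  fixes Pri Post :: "'a measure" and \<Omega> :: "'p::euclidean_space set"
  assumes "prob_space Post" "\<Psi> \<in> measurable Post (vol \<Omega>)" "open \<Omega>"
    and "countable (C ` \<Omega>)" "partition_on \<Omega> (C ` \<Omega>)"
    and "\<And>\<psi>. \<psi> \<in> \<Omega> \<Longrightarrow> \<psi> \<in> C \<psi> \<and> C \<psi> \<in> sets (vol \<Omega>)"
    and "\<And>\<psi>. \<psi> \<in> \<Omega> \<Longrightarrow> s \<psi> \<in> C \<psi>"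
    and "\<And>\<psi> \<psi>'. \<psi> \<in> \<Omega> \<Longrightarrow> \<psi>' \<in> C \<psi> \<Longrightarrow> s \<psi>' = s \<psi>"
    and "\<eta> > 0"
  defines "R \<equiv> \<lambda>a. disc_mass (marginal Post \<Psi> \<Omega>) C a / max \<eta> (disc_mass (marginal Pri \<Psi> \<Omega>) C a)"
  shows "disc_lpl_region \<Omega> Pri Post \<Psi> C s \<eta> \<gamma> =
    {a \<in> s ` \<Omega>. ereal (R a) \<ge> Sup (ereal `
       {k. measure (disc_measure \<Omega> (marginal Post \<Psi> \<Omega>) C s) {b \<in> s ` \<Omega>. R b \<ge> k} \<ge> \<gamma>})}"
proof -
  let ?r = "disc_risk (marginal Pri \<Psi> \<Omega>) Post \<Psi> C s \<eta>"
  let ?D = "disc_measure \<Omega> (marginal Post \<Psi> \<Omega>) C s"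
  obtain S where S: "\<And>a. a \<in> s ` \<Omega> \<Longrightarrow> ?r a = S - R a"
    using disc_risk_eq[OF assms(1-9)] unfolding R_def by blast
  have sets_eq: "{b \<in> s ` \<Omega>. ?r b \<le> d} = {b \<in> s ` \<Omega>. R b \<ge> S - d}" for d
    using S by auto
  have "(\<forall>d. measure ?D {b \<in> s ` \<Omega>. ?r b \<le> d} \<ge> \<gamma> \<longrightarrow> ?r a \<le> d) \<longleftrightarrow>
        (\<forall>k. measure ?D {b \<in> s ` \<Omega>. R b \<ge> k} \<ge> \<gamma> \<longrightarrow> k \<le> R a)" if "a \<in> s ` \<Omega>" for a
  proof (intro iffI allI impI)
    fix k assume *: "\<forall>d. measure ?D {b \<in> s ` \<Omega>. ?r b \<le> d} \<ge> \<gamma> \<longrightarrow> ?r a \<le> d"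
      and k: "measure ?D {b \<in> s ` \<Omega>. R b \<ge> k} \<ge> \<gamma>"
    show "k \<le> R a" using *[rule_format, of "S - k"] k S[OF that] unfolding sets_eq by simp
  next
    fix d assume *: "\<forall>k. measure ?D {b \<in> s ` \<Omega>. R b \<ge> k} \<ge> \<gamma> \<longrightarrow> k \<le> R a"
      and d: "measure ?D {b \<in> s ` \<Omega>. ?r b \<le> d} \<ge> \<gamma>"
    show "?r a \<le> d" using *[rule_format, of "S - d"] d S[OF that] unfolding sets_eq by simp
  qed
  thus ?thesis
    unfolding disc_lpl_region_def lowest_risk_region_def by (auto simp: le_Inf_iff Sup_le_iff)
qed

end

theory Submission
  imports Defs
begin

text \<open>Let \<open>P\<close> and \<open>Q\<close> be the marginal posterior and prior, \<open>r = p / q\<close> the ratio of their densities,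
  and \<open>F k = P {r \<ge> k}\<close>. The region \<open>C\<^sub>\<gamma>\<close> consists of the points with \<open>r\<close> at least the supremum of the
  levels whose tail is at least \<open>\<gamma>\<close>. By the closed form of the posterior risk, the undiscretized lowest
  posterior loss region is the region of the same kind for the cellwise ratio
  \<open>P (B \<psi>) / max \<eta> (Q (B \<psi>))\<close> (\<open>undiscretize_disc_lpl_region\<close>).

  Letting \<open>\<eta>\<close> tend to 0 restores the ratio \<open>R = P (B \<psi>) / Q (B \<psi>)\<close>, and refining the partition turns
  \<open>R\<close> into \<open>r\<close> at every continuity point of \<open>p\<close> (\<open>tendsto_density_average\<close>). As \<open>r\<close> has no atoms, the tails
  of \<open>R\<close> converge to \<open>F\<close> (\<open>tendsto_tail\<close>).
  The cutoffs, however, need not converge, since \<open>F\<close> may be flat at height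
  \<open>\<gamma>\<close>. The remedy is to look at a single point \<open>\<psi>\<close>. If \<open>F (r
  \<psi>) < \<gamma>\<close>, continuity of \<open>F\<close> provides a level \<open>k < r \<psi>\<close>
  with \<open>F k < \<gamma>\<close>, and this level witnesses membership of \<open>\<psi>\<close> in
  \<open>C\<^sub>\<gamma>\<close> and, both inequalities being strict, in the
  approximating regions for all small parameters. If \<open>F (r \<psi>) > \<gamma>\<close>, a level \<open>k > r \<psi>\<close> with
  \<open>F k > \<gamma>\<close> excludes \<open>\<psi>\<close> from all of them in the same way
  (\<open>eventually_mem_iff_mem_surprise_region\<close>). So membership stabilizes, and lower and upper limits
  agree.

  It remains that \<open>F (r \<psi>) = \<gamma>\<close> only on a null set. For \<open>P\<close> this is the probability integral transform
  (\<open>AE_tail_at_own_value_neq\<close>). It carries over to \<open>Q\<close> on the set \<open>p > 0\<close>, while \<open>p \<psi> = 0\<close> gives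
  \<open>F (r \<psi>) = F 0 = 1\<close>, which differs from \<open>\<gamma>\<close> unless \<open>\<gamma> = 1\<close>; in that case \<open>p > 0\<close> almost everywhere.\<close>

section \<open>Limits of sets along a parameter decreasing to 0\<close>

lemma mem_liminf0_iff: "x \<in> liminf0 A \<longleftrightarrow> (\<forall>\<^sub>F t in at_right 0. x \<in> A t)"
  unfolding liminf0_def eventually_at_right_field UN_iff INT_iff Ball_def Bex_def
    greaterThan_iff greaterThanLessThan_iff by blast

lemma mem_limsup0_iff: "x \<in> limsup0 A \<longleftrightarrow> (\<exists>\<^sub>F t in at_right 0. x \<in> A t)"
  unfolding limsup0_def frequently_def eventually_at_right_field UN_iff INT_iff Ball_def Bex_def
    greaterThan_iff greaterThanLessThan_iff by blast

text \<open>Working with one point at a time avoids any measurability question for the uncountable unions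
  and intersections in \<^const>\<open>liminf0\<close> and \<^const>\<open>limsup0\<close>.\<close>
lemma set_lim0_if_AE_eventually:
  assumes "AE x in M. \<forall>\<^sub>F t in at_right 0. x \<in> A t \<longleftrightarrow> x \<in> S"
  shows "set_lim0 M A S"
proof -
  have *: "(x \<in> liminf0 A \<longleftrightarrow> x \<in> S) \<and> (x \<in> limsup0 A \<longleftrightarrow> x \<in> S)"
    if "\<forall>\<^sub>F t in at_right 0. x \<in> A t \<longleftrightarrow> x \<in> S" for x
  proof -
    have "(\<forall>\<^sub>F t in at_right 0. x \<in> A t) \<longleftrightarrow> (\<forall>\<^sub>F t in at_right (0::real). x \<in> S)"
      by (rule eventually_cong[OF that]) simp
    moreover have "(\<exists>\<^sub>F t in at_right 0. x \<in> A t) \<longleftrightarrow> (\<exists>\<^sub>F t in at_right (0::real). x \<in> S)"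
      by (rule frequently_cong[OF that]) simp
    ultimately show ?thesis
      unfolding mem_liminf0_iff mem_limsup0_iff
      by (simp add: eventually_const_iff frequently_const_iff)
  qed
  show ?thesis
    unfolding set_lim0_def eq_mod_null_def using assms * by (auto elim!: eventually_mono)
qed

text \<open>Continuity of the measure from dominated convergence of the indicators. The parameter is
  continuous, so the limit is first reduced to sequences of parameters.\<close>
lemma (in finite_measure) tendsto_measure_if_AE_eventually:
  assumes "\<And>t. t > 0 \<Longrightarrow> A t \<in> sets M" and "S \<in> sets M"
    and "AE x in M. \<forall>\<^sub>F t in at_right 0. x \<in> A t \<longleftrightarrow> x \<in> S"
  shows "((\<lambda>t::real. measure M (A t)) \<longlongrightarrow> measure M S) (at_right 0)"
  unfolding tendsto_at_iff_sequentially
proof (intro allI impI)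
  fix X :: "nat \<Rightarrow> real" assume X: "\<forall>i. X i \<in> {0<..} - {0}" "X \<longlonglongrightarrow> 0"
  have lim: "filterlim X (at_right 0) sequentially"
    using X by (auto simp: filterlim_at less_imp_neq[symmetric] dest: less_imp_neq intro!: always_eventually)
  have "(\<lambda>i. LINT x|M. indicator (A (X i)) x :: real) \<longlonglongrightarrow> (LINT x|M. indicator S x)"
  proof (rule integral_dominated_convergence[where w = "\<lambda>_. 1"])
    show "AE x in M. (\<lambda>i. indicator (A (X i)) x :: real) \<longlonglongrightarrow> indicator S x"
      using assms(3)
    proof eventually_elim
      case (elim x)
      hence "\<forall>\<^sub>F i in sequentially. x \<in> A (X i) \<longleftrightarrow> x \<in> S"
        by (rule eventually_compose_filterlim) (rule lim)
      thus ?case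
        by (intro tendsto_eventually) (auto elim!: eventually_mono simp: indicator_def)
    qed
  qed (use assms X in \<open>auto simp: indicator_def\<close>)
  thus "((\<lambda>t. measure M (A t)) \<circ> X) \<longlonglongrightarrow> measure M S"
    using assms X by (simp add: comp_def)
qed

section \<open>Tail functions of a random variable without atoms\<close>

text \<open>At a point with \<open>r x \<noteq> k\<close> the condition \<open>R t x \<ge> k\<close> is settled by the limit once \<open>t\<close> is small;
  the remaining points form a null set since \<open>k\<close> is not an atom.\<close>
lemma (in finite_measure) tendsto_tail:
  fixes r :: "'a \<Rightarrow> real"
  assumes "r \<in> borel_measurable M" and "\<And>t. t > 0 \<Longrightarrow> R t \<in> borel_measurable M"
    and lim: "AE x in M. ((\<lambda>t::real. R t x) \<longlongrightarrow> r x) (at_right 0)"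
    and atom: "measure M {x \<in> space M. r x = k} = 0"
  shows "((\<lambda>t. measure M {x \<in> space M. R t x \<ge> k}) \<longlongrightarrow> measure M {x \<in> space M. r x \<ge> k})
    (at_right 0)"
proof (rule tendsto_measure_if_AE_eventually)
  have "AE x in M. r x \<noteq> k"
    by (rule AE_I[where N = "{x \<in> space M. r x = k}"])
      (use atom assms(1) in \<open>auto simp: emeasure_eq_measure\<close>)
  with lim show "AE x in M. \<forall>\<^sub>F t in at_right 0.
      x \<in> {x \<in> space M. R t x \<ge> k} \<longleftrightarrow> x \<in> {x \<in> space M. r x \<ge> k}"
  proof eventually_elim
    case (elim x)
    show ?case
    proof (cases "r x > k")
      case True
      from order_tendstoD(1)[OF elim(1) True] show ?thesis
        by eventually_elim (use True in auto)
    next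
      case False
      hence "r x < k" using elim by simp
      from order_tendstoD(2)[OF elim(1) this] show ?thesis
        by eventually_elim (use False elim in auto)
    qed
  qed
qed (use assms(1,2) in measurable)

lemma (in finite_measure) tail_antimono:
  fixes r :: "'a \<Rightarrow> real"
  assumes "r \<in> borel_measurable M" and "a \<le> b"
  shows "measure M {x \<in> space M. r x \<ge> b} \<le> measure M {x \<in> space M. r x \<ge> a}"
  by (rule finite_measure_mono) (use assms in \<open>auto\<close>)

text \<open>One half of the probability integral transform: for atomless \<open>r\<close> with tail function \<open>F\<close> the
  variable \<open>F (r x)\<close> has no atoms either. The reason is that \<open>F\<close> is constant on the level set
  \<open>{t. F t = g}\<close>, an interval, so \<open>r\<close> charges no half-open interval with end points in it; such
  intervals with rational end points exhaust it up to its two end points, which are not atoms.\<close>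
lemma (in finite_measure) AE_tail_at_own_value_neq:
  fixes r :: "'a \<Rightarrow> real"
  assumes r[measurable]: "r \<in> borel_measurable M"
    and atom: "\<And>t. measure M {x \<in> space M. r x = t} = 0"
  defines "F \<equiv> \<lambda>k. measure M {x \<in> space M. r x \<ge> k}"
  shows "AE x in M. F (r x) \<noteq> g"
proof -
  define S where "S = {t. F t = g}"
  have anti: "F b \<le> F a" if "a \<le> b" for a b
    unfolding F_def by (rule tail_antimono[OF r that])
  have neq: "AE x in M. r x \<noteq> t" for t
    by (rule AE_I[where N = "{x \<in> space M. r x = t}"])
      (use atom in \<open>auto simp: emeasure_eq_measure\<close>)
  have gap: "AE x in M. \<not> (a \<le> r x \<and> r x < b)" if "a \<in> S" "b \<in> S" for a b
  proof (cases "a \<le> b")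
    case True
    have "measure M {x \<in> space M. a \<le> r x \<and> r x < b} = F a - F b"
      unfolding F_def
      by (subst finite_measure_Diff[symmetric]) (use True in \<open>auto intro!: arg_cong[where f = "measure M"]\<close>)
    also have "\<dots> = 0" using that by (simp add: S_def)
    finally show ?thesis
      by (intro AE_I[where N = "{x \<in> space M. a \<le> r x \<and> r x < b}"])
        (auto simp: emeasure_eq_measure)
  qed auto
  (* Membership in S stays inside the quantifiers so that both range over a fixed countable set. *)
  have "AE x in M. \<forall>a\<in>\<rat>. \<forall>b\<in>\<rat>. a \<in> S \<longrightarrow> b \<in> S \<longrightarrow> \<not> (a \<le> r x \<and> r x < b)"
    using gap by (auto simp: AE_ball_countable countable_rat)
  (* If S has no least (greatest) element or is unbounded, the exclusion of Inf S (Sup S) is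
     harmless; only an attained extremum is used below. *)
  with neq[of "Inf S"] neq[of "Sup S"] show ?thesis
  proof eventually_elim
    case (elim x)
    show ?case
    proof
      assume "F (r x) = g"
      hence rS: "r x \<in> S" by (simp add: S_def)
      have "\<exists>u\<in>S. u < r x"
        using elim(1) cInf_eq_minimum[OF rS] by (metis not_le)
      moreover have "\<exists>v\<in>S. r x < v"
        using elim(2) cSup_eq_maximum[OF rS] by (metis not_le)
      ultimately obtain u v where uv: "u \<in> S" "v \<in> S" "u < r x" "r x < v" by blast
      obtain a where a: "a \<in> \<rat>" "u < a" "a < r x" using Rats_dense_in_real[OF uv(3)] by auto
      obtain b where b: "b \<in> \<rat>" "r x < b" "b < v" using Rats_dense_in_real[OF uv(4)] by auto
      have "a \<in> S" "b \<in> S"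
        using anti[of u a] anti[of a "r x"] anti[of "r x" b] anti[of b v] uv a b rS
        by (auto simp: S_def)
      thus False using elim(3) a b by (meson less_imp_le)
    qed
  qed
qed

text \<open>One-sided continuity of the tail function at a non-atom, in the form that yields a level
  strictly beyond \<open>t\<close> on the same side of \<open>g\<close>. Both lemmas come from the convergence of tails applied to the
  constant shifts \<open>r + e\<close> and \<open>r - e\<close>.\<close>
lemma (in finite_measure) tail_less_below:
  fixes r :: "'a \<Rightarrow> real"
  assumes r: "r \<in> borel_measurable M" and atom: "measure M {x \<in> space M. r x = t} = 0"
    and less: "measure M {x \<in> space M. r x \<ge> t} < g"
  obtains k where "k < t" "measure M {x \<in> space M. r x \<ge> k} < g"
proof -
  have "((\<lambda>e. measure M {x \<in> space M. r x + e \<ge> t}) \<longlongrightarrow> measure M {x \<in> space M. r x \<ge> t})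
      (at_right 0)"
    by (rule tendsto_tail) (use r atom in \<open>auto intro!: AE_I2 tendsto_eq_intros\<close>)
  from order_tendstoD(2)[OF this less]
  have "\<forall>\<^sub>F e in at_right 0. 0 < e \<and> measure M {x \<in> space M. r x + e \<ge> t} < g"
    by (intro eventually_conj eventually_at_right_less)
  then obtain e where "0 < e" "measure M {x \<in> space M. r x + e \<ge> t} < g"
    using eventually_happens'[OF trivial_limit_at_right_real] by blast
  thus thesis using that[of "t - e"] by (simp add: algebra_simps)
qed

lemma (in finite_measure) tail_greater_above:
  fixes r :: "'a \<Rightarrow> real"
  assumes r: "r \<in> borel_measurable M" and atom: "measure M {x \<in> space M. r x = t} = 0"
    and less: "measure M {x \<in> space M. r x \<ge> t} > g"
  obtains k where "k > t" "measure M {x \<in> space M. r x \<ge> k} > g"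
proof -
  have "((\<lambda>e. measure M {x \<in> space M. r x - e \<ge> t}) \<longlongrightarrow> measure M {x \<in> space M. r x \<ge> t})
      (at_right 0)"
    by (rule tendsto_tail) (use r atom in \<open>auto intro!: AE_I2 tendsto_eq_intros\<close>)
  from order_tendstoD(1)[OF this less]
  have "\<forall>\<^sub>F e in at_right 0. 0 < e \<and> measure M {x \<in> space M. r x - e \<ge> t} > g"
    by (intro eventually_conj eventually_at_right_less)
  then obtain e where "0 < e" "measure M {x \<in> space M. r x - e \<ge> t} > g"
    using eventually_happens'[OF trivial_limit_at_right_real] by blast
  thus thesis using that[of "t + e"] by (simp add: algebra_simps)
qed

section \<open>Membership in a surprise region from a single level\<close>

text \<open>The extended-real cutoff enters the rest of the proof only through the next two criteria: a level
  with too little posterior content bounds the cutoff above, a level with enough of it bounds the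
  cutoff below. They also cover an infinite cutoff.\<close>
lemma mem_surprise_region_if_tail_less:
  assumes sp: "space P = \<Omega>" and fin: "finite_measure P"
    and m: "(\<lambda>\<psi>. p \<psi> / q \<psi>) \<in> borel_measurable P" and "\<psi> \<in> \<Omega>"
    and "measure P {\<psi>\<in>\<Omega>. p \<psi> / q \<psi> \<ge> k} < \<gamma>" and "k \<le> p \<psi> / q \<psi>"
  shows "\<psi> \<in> surprise_region \<Omega> P p q \<gamma>"
proof -
  interpret finite_measure P by fact
  have "k' \<le> k" if "measure P {\<psi>\<in>\<Omega>. p \<psi> / q \<psi> \<ge> k'} \<ge> \<gamma>" for k'
    using tail_antimono[OF m, of k k'] that assms(5) by (force simp: sp)
  thus ?thesis
    using assms(4,6) by (force simp: surprise_region_def surprise_cutoff_def Sup_le_iff)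
qed

lemma notin_surprise_region_if_tail_ge:
  assumes "measure P {\<psi>\<in>\<Omega>. p \<psi> / q \<psi> \<ge> k} \<ge> \<gamma>" and "p \<psi> / q \<psi> < k"
  shows "\<psi> \<notin> surprise_region \<Omega> P p q \<gamma>"
  using assms by (auto simp: surprise_region_def surprise_cutoff_def Sup_le_iff not_le)

section \<open>The discretized region as a surprise region on cells\<close>

locale cell_system =
  fixes \<Omega> :: "'p::euclidean_space set" and C :: "'p \<Rightarrow> 'p set" and s :: "'p \<Rightarrow> 'p"
  assumes cnt: "countable (C ` \<Omega>)" and part: "partition_on \<Omega> (C ` \<Omega>)"
    and cell: "\<And>\<psi>. \<psi> \<in> \<Omega> \<Longrightarrow> \<psi> \<in> C \<psi> \<and> C \<psi> \<in> sets (vol \<Omega>)"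
    and rep: "\<And>\<psi>. \<psi> \<in> \<Omega> \<Longrightarrow> s \<psi> \<in> C \<psi>"
    and rep_const: "\<And>\<psi> \<psi>'. \<psi> \<in> \<Omega> \<Longrightarrow> \<psi>' \<in> C \<psi> \<Longrightarrow> s \<psi>' = s \<psi>"
begin

lemma cell_subset: "\<psi> \<in> \<Omega> \<Longrightarrow> C \<psi> \<subseteq> \<Omega>"
  using partition_onD1[OF part] by blast

lemma cell_eq: "\<psi> \<in> \<Omega> \<Longrightarrow> \<psi>' \<in> C \<psi> \<Longrightarrow> C \<psi>' = C \<psi>"
  using partition_onD2[OF part] cell cell_subset unfolding disjoint_def by blast

lemma cell_rep: "\<psi> \<in> \<Omega> \<Longrightarrow> C (s \<psi>) = C \<psi>"
  by (rule cell_eq[OF _ rep])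

lemma rep_in: "\<psi> \<in> \<Omega> \<Longrightarrow> s \<psi> \<in> \<Omega>"
  using cell_subset rep by blast

lemma countable_rep: "countable (s ` \<Omega>)"
proof -
  have "s ` \<Omega> \<subseteq> (\<lambda>c. s (SOME z. z \<in> c)) ` (C ` \<Omega>)"
  proof
    fix a assume "a \<in> s ` \<Omega>"
    then obtain \<psi> where \<psi>: "\<psi> \<in> \<Omega>" "a = s \<psi>" by auto
    have "(SOME z. z \<in> C \<psi>) \<in> C \<psi>" using cell[OF \<psi>(1)] by (auto intro: someI)
    thus "a \<in> (\<lambda>c. s (SOME z. z \<in> c)) ` (C ` \<Omega>)" using rep_const[OF \<psi>(1)] \<psi> by force
  qed
  thus ?thesis by (rule countable_subset) (intro countable_image cnt)
qed

lemma measurable_cell_function: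
  assumes "sets M = sets (vol \<Omega>)"
  shows "(\<lambda>\<psi>. h (C \<psi>) :: real) \<in> borel_measurable M"
proof (rule cell_constant_measurable[OF cnt part])
  show "space M = \<Omega>" using sets_eq_imp_space_eq[OF assms] by (simp add: space_restrict_space)
next
  show "h (C \<psi>') = h (C \<psi>)" if "\<psi> \<in> \<Omega>" "\<psi>' \<in> C \<psi>" for \<psi> \<psi>'
    using cell_eq[OF that] by simp
qed (simp add: cell assms)

lemma Union_cells_rep: "(\<Union>b\<in>{b \<in> s ` \<Omega>. T (C b)}. C b) = {\<psi> \<in> \<Omega>. T (C \<psi>)}"
proof (intro set_eqI iffI)
  fix z assume z: "z \<in> {\<psi> \<in> \<Omega>. T (C \<psi>)}"
  hence "s z \<in> {b \<in> s ` \<Omega>. T (C b)}" "z \<in> C (s z)" using cell[of z] cell_rep[of z] by auto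
  thus "z \<in> (\<Union>b\<in>{b \<in> s ` \<Omega>. T (C b)}. C b)" by (rule UN_I)
next
  fix z assume "z \<in> (\<Union>b\<in>{b \<in> s ` \<Omega>. T (C b)}. C b)"
  then obtain \<psi> where "\<psi> \<in> \<Omega>" "T (C \<psi>)" "z \<in> C \<psi>" using cell_rep by auto
  thus "z \<in> {\<psi> \<in> \<Omega>. T (C \<psi>)}" using cell_subset[of \<psi>] cell_eq[of \<psi> z] by auto
qed

text \<open>Cells with different representatives are disjoint and there are countably many of them, so the
  sum over representatives is the measure of the union of their cells.\<close>
lemma measure_disc_measure:
  assumes fin: "finite_measure P" and sets: "sets P = sets (vol \<Omega>)"
  shows "measure (disc_measure \<Omega> P C s) {b \<in> s ` \<Omega>. T (C b)} = measure P {\<psi> \<in> \<Omega>. T (C \<psi>)}"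
proof -
  interpret finite_measure P by fact
  let ?A = "{b \<in> s ` \<Omega>. T (C b)}"
  have disj: "disjoint_family_on C ?A"
  proof (unfold disjoint_family_on_def, intro ballI impI)
    fix a b assume "a \<in> ?A" "b \<in> ?A" "a \<noteq> b"
    then obtain u v where uv: "u \<in> \<Omega>" "v \<in> \<Omega>" "a = s u" "b = s v" by auto
    have False if "z \<in> C u" "z \<in> C v" for z
      using rep_const[OF uv(1) that(1)] rep_const[OF uv(2) that(2)] uv \<open>a \<noteq> b\<close> by simp
    thus "C a \<inter> C b = {}" using uv cell_rep by auto
  qed
  have "emeasure (disc_measure \<Omega> P C s) ?A =
      (\<integral>\<^sup>+b. ennreal (disc_mass P C b) * indicator ?A b \<partial>count_space (s ` \<Omega>))"
    unfolding disc_measure_def point_measure_def by (rule emeasure_density) auto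
  also have "\<dots> = (\<integral>\<^sup>+b. emeasure P (C b) \<partial>count_space ?A)"
    by (subst nn_integral_count_space_indicator)
      (auto simp: nn_integral_count_space_indicator disc_mass_def emeasure_eq_measure indicator_def
        intro!: nn_integral_cong)
  also have "\<dots> = emeasure P (\<Union>b\<in>?A. C b)"
    by (rule emeasure_UN_countable[symmetric])
      (use cell rep_in sets disj countable_rep in \<open>auto intro: countable_subset[of _ "s ` \<Omega>"]\<close>)
  finally show ?thesis unfolding Union_cells_rep by (simp add: measure_def)
qed

text \<open>Minimizing posterior risk is maximizing the ratio of cell masses truncated by \<open>\<eta>\<close>, and this ratio
  depends on the cell only. Hence the undiscretized region is literally a \<^const>\<open>surprise_region\<close>, so
  that the criteria above serve the discretized and the limiting problem alike.\<close>
lemma undiscretize_disc_lpl_region: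
  assumes post: "prob_space Post" and \<Psi>: "\<Psi> \<in> measurable Post (vol \<Omega>)" and "open \<Omega>" and "\<eta> > 0"
  shows "undiscretize C (disc_lpl_region \<Omega> Pri Post \<Psi> C s \<eta> \<gamma>) =
    surprise_region \<Omega> (marginal Post \<Psi> \<Omega>)
      (\<lambda>\<psi>. measure (marginal Post \<Psi> \<Omega>) (C \<psi>)) (\<lambda>\<psi>. max \<eta> (measure (marginal Pri \<Psi> \<Omega>) (C \<psi>))) \<gamma>"
proof -
  let ?P = "marginal Post \<Psi> \<Omega>" and ?Q = "marginal Pri \<Psi> \<Omega>"
  define g where "g c = measure ?P c / max \<eta> (measure ?Q c)" for c
  have fin: "finite_measure ?P"
    unfolding marginal_def using prob_space.prob_space_distr[OF post \<Psi>]
    by (rule prob_space.finite_measure)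
  have tail: "measure (disc_measure \<Omega> ?P C s) {b \<in> s ` \<Omega>. g (C b) \<ge> k} =
      measure ?P {\<psi> \<in> \<Omega>. g (C \<psi>) \<ge> k}" for k
    by (rule measure_disc_measure[OF fin]) (simp add: marginal_def)
  have g_eq: "g (C a) = disc_mass ?P C a / max \<eta> (disc_mass ?Q C a)" for a
    by (simp add: g_def disc_mass_def)
  define l where "l = Sup (ereal ` {k. measure ?P {\<psi> \<in> \<Omega>. g (C \<psi>) \<ge> k} \<ge> \<gamma>})"
  have reg: "disc_lpl_region \<Omega> Pri Post \<Psi> C s \<eta> \<gamma> = {a \<in> s ` \<Omega>. ereal (g (C a)) \<ge> l}"
    unfolding l_def tail[symmetric] unfolding g_eq
    by (rule disc_lpl_region_eq[OF post \<Psi> assms(3) cnt part _ _ _ assms(4)])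
      (rule cell rep rep_const; assumption)+
  have sur: "surprise_region \<Omega> ?P (\<lambda>\<psi>. measure ?P (C \<psi>)) (\<lambda>\<psi>. max \<eta> (measure ?Q (C \<psi>))) \<gamma> =
      {\<psi> \<in> \<Omega>. ereal (g (C \<psi>)) \<ge> l}"
    unfolding surprise_region_def surprise_cutoff_def g_def[symmetric] l_def ..
  show ?thesis
    unfolding reg sur undiscretize_def by (rule Union_cells_rep)
qed

end

section \<open>Densities as limits of cell averages\<close>

lemma dist_le_ediam: "a \<in> S \<Longrightarrow> b \<in> S \<Longrightarrow> ennreal (dist a b) \<le> ediam S"
  unfolding ediam_def by (intro SUP_upper2[of a S] SUP_upper2[of b S]) auto

text \<open>Near a continuity point the density is squeezed between constants on a small set, hence so is its
  average. Positive \<^const>\<open>measure\<close> also encodes finite volume, because the \<^const>\<open>measure\<close> of a set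
  of infinite volume is 0.\<close>
lemma tendsto_density_average:
  fixes p :: "'p::euclidean_space \<Rightarrow> real" and B :: "'i \<Rightarrow> 'p set" and M :: "'p measure"
  assumes [measurable]: "(\<lambda>y. ennreal (p y)) \<in> borel_measurable M"
    and nonneg: "\<forall>y\<in>space M. p y \<ge> 0" and cont: "isCont p x"
    and B: "\<forall>\<^sub>F i in F. B i \<in> sets M \<and> x \<in> B i \<and> measure M (B i) > 0"
    and diam: "((\<lambda>i. ediam (B i)) \<longlongrightarrow> 0) F"
    and fin: "finite_measure (density M (\<lambda>y. ennreal (p y)))"
  shows "((\<lambda>i. measure (density M (\<lambda>y. ennreal (p y))) (B i) / measure M (B i)) \<longlongrightarrow> p x) F"
proof (rule tendstoI)
  let ?P = "density M (\<lambda>y. ennreal (p y))"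
  interpret P: finite_measure ?P by fact
  fix e :: real assume "e > 0"
  then obtain d where d: "d > 0" "\<And>y. dist y x < d \<Longrightarrow> dist (p y) (p x) < e / 2"
    using cont[unfolded continuous_at_eps_delta] by (metis half_gt_zero)
  have "\<forall>\<^sub>F i in F. ediam (B i) < ennreal d"
    using order_tendstoD(2)[OF diam] d(1) by simp
  with B show "\<forall>\<^sub>F i in F. dist (measure ?P (B i) / measure M (B i)) (p x) < e"
  proof eventually_elim
    case (elim i)
    hence Bi[measurable]: "B i \<in> sets M" and "x \<in> B i" and v: "measure M (B i) > 0" by auto
    define v where "v = measure M (B i)"
    have em: "emeasure M (B i) = ennreal v"
      using v unfolding v_def by (metis emeasure_eq_ennreal_measure measure_zero_top less_irrefl)
    have near: "p x - e / 2 \<le> p y \<and> p y \<le> p x + e / 2" if "y \<in> B i" for y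
    proof -
      have "ennreal (dist y x) < ennreal d"
        using dist_le_ediam[OF that \<open>x \<in> B i\<close>] elim by (metis le_less_trans)
      hence "dist y x < d" using ennreal_less_iff by fastforce
      from d(2)[OF this] show ?thesis unfolding dist_real_def by linarith
    qed
    have P: "emeasure ?P (B i) = (\<integral>\<^sup>+y. ennreal (p y) * indicator (B i) y \<partial>M)"
      by (rule emeasure_density) auto
    have "emeasure ?P (B i) \<le> (\<integral>\<^sup>+y. ennreal (p x + e / 2) * indicator (B i) y \<partial>M)"
      unfolding P by (intro nn_integral_mono) (use near in \<open>auto simp: indicator_def intro!: ennreal_leI\<close>)
    also have "\<dots> = ennreal (p x + e / 2) * ennreal v"
      by (simp add: nn_integral_cmult_indicator em)
    finally have "emeasure ?P (B i) \<le> ennreal (p x + e / 2) * ennreal v" .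
    moreover have "p x \<ge> 0"
      using nonneg \<open>x \<in> B i\<close> sets.sets_into_space[OF Bi] by auto
    ultimately have up: "measure ?P (B i) \<le> (p x + e / 2) * v"
      using \<open>e > 0\<close> v by (simp add: P.emeasure_eq_measure ennreal_mult[symmetric] v_def del: ennreal_plus)
    have "ennreal (p x - e / 2) * ennreal v = (\<integral>\<^sup>+y. ennreal (p x - e / 2) * indicator (B i) y \<partial>M)"
      by (simp add: nn_integral_cmult_indicator em)
    also have "\<dots> \<le> emeasure ?P (B i)"
      unfolding P by (intro nn_integral_mono) (use near in \<open>auto simp: indicator_def intro!: ennreal_leI\<close>)
    finally have "ennreal ((p x - e / 2) * v) \<le> ennreal (measure ?P (B i))"
      using v by (simp add: P.emeasure_eq_measure ennreal_mult'' v_def)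
    hence lo: "(p x - e / 2) * v \<le> measure ?P (B i)"
      by (simp add: ennreal_le_iff)
    have "p x - e / 2 \<le> measure ?P (B i) / v" "measure ?P (B i) / v \<le> p x + e / 2"
      using up lo v by (auto simp: v_def field_simps)
    thus ?case using \<open>e > 0\<close> by (simp add: v_def dist_real_def abs_less_iff)
  qed
qed

section \<open>Small truncation and small cells\<close>

text \<open>The truncated ratio \<open>a / max \<eta> b\<close> never exceeds \<open>a / b\<close>, so truncation can only lower tails and
  the level \<open>k\<close> keeps too little content for every \<open>\<eta>\<close>. At the point \<open>\<psi>\<close> itself the two ratios
  agree once \<open>\<eta> < b \<psi>\<close>.\<close>
lemma eventually_mem_surprise_region_truncated:
  assumes sp: "space P = \<Omega>" and fin: "finite_measure P"
    and [measurable]: "a \<in> borel_measurable P" "b \<in> borel_measurable P"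
    and a: "\<forall>y\<in>\<Omega>. a y \<ge> 0" and b: "\<forall>y\<in>\<Omega>. b y > 0" and \<psi>: "\<psi> \<in> \<Omega>"
    and tail: "measure P {y\<in>\<Omega>. a y / b y \<ge> k} < \<gamma>" and k: "k \<le> a \<psi> / b \<psi>"
  shows "\<forall>\<^sub>F \<eta> in at_right 0. \<psi> \<in> surprise_region \<Omega> P a (\<lambda>y. max \<eta> (b y)) \<gamma>"
proof -
  interpret finite_measure P by fact
  have "\<forall>\<^sub>F \<eta> in at_right 0. 0 < \<eta> \<and> \<eta> < b \<psi>"
    using b \<psi> by (intro eventually_conj eventually_at_right_less order_tendstoD(2)[OF tendsto_ident_at]) auto
  thus ?thesis
  proof eventually_elim
    case (elim \<eta>)
    show ?case
    proof (rule mem_surprise_region_if_tail_less[OF sp fin _ \<psi>])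
      have "measure P {y\<in>\<Omega>. a y / max \<eta> (b y) \<ge> k} \<le> measure P {y\<in>\<Omega>. a y / b y \<ge> k}"
      proof (rule finite_measure_mono)
        have "a y / max \<eta> (b y) \<le> a y / b y" if "y \<in> \<Omega>" for y
          using a b that by (intro divide_left_mono) (auto intro!: mult_pos_pos simp: less_max_iff_disj)
        thus "{y\<in>\<Omega>. a y / max \<eta> (b y) \<ge> k} \<subseteq> {y\<in>\<Omega>. a y / b y \<ge> k}" by force
        show "{y\<in>\<Omega>. a y / b y \<ge> k} \<in> sets P" unfolding sp[symmetric] by measurable
      qed
      thus "measure P {y\<in>\<Omega>. a y / max \<eta> (b y) \<ge> k} < \<gamma>" using tail by simp
      show "k \<le> a \<psi> / max \<eta> (b \<psi>)" using elim k by simp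
    qed measurable
  qed
qed

text \<open>Here tails of the truncated ratio must not drop below \<open>\<gamma>\<close>. They converge to the untruncated tail
  because each point is eventually unaffected, and a strict inequality survives the limit. With
  content exactly \<open>\<gamma>\<close> at level \<open>k\<close> this could fail: if \<open>b\<close> comes arbitrarily close to 0, every
  truncation may push some points below the level \<open>k\<close>.\<close>
lemma eventually_notin_surprise_region_truncated:
  assumes sp: "space P = \<Omega>" and fin: "finite_measure P"
    and [measurable]: "a \<in> borel_measurable P" "b \<in> borel_measurable P"
    and a: "\<forall>y\<in>\<Omega>. a y \<ge> 0" and b: "\<forall>y\<in>\<Omega>. b y > 0" and \<psi>: "\<psi> \<in> \<Omega>"
    and tail: "measure P {y\<in>\<Omega>. a y / b y \<ge> k} > \<gamma>" and k: "k > a \<psi> / b \<psi>"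
  shows "\<forall>\<^sub>F \<eta> in at_right 0. \<psi> \<notin> surprise_region \<Omega> P a (\<lambda>y. max \<eta> (b y)) \<gamma>"
proof -
  interpret finite_measure P by fact
  have small: "\<forall>\<^sub>F \<eta> in at_right 0. 0 < \<eta> \<and> \<eta> < b y" if "y \<in> \<Omega>" for y
    using b that by (intro eventually_conj eventually_at_right_less order_tendstoD(2)[OF tendsto_ident_at]) auto
  have "((\<lambda>\<eta>. measure P {y\<in>\<Omega>. a y / max \<eta> (b y) \<ge> k}) \<longlongrightarrow> measure P {y\<in>\<Omega>. a y / b y \<ge> k})
      (at_right 0)"
  proof (rule tendsto_measure_if_AE_eventually)
    show "AE y in P. \<forall>\<^sub>F \<eta> in at_right 0.
        y \<in> {y\<in>\<Omega>. a y / max \<eta> (b y) \<ge> k} \<longleftrightarrow> y \<in> {y\<in>\<Omega>. a y / b y \<ge> k}"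
    proof (rule AE_I2)
      fix y assume "y \<in> space P"
      hence "y \<in> \<Omega>" by (simp add: sp)
      from small[OF this] show "\<forall>\<^sub>F \<eta> in at_right 0.
        y \<in> {y\<in>\<Omega>. a y / max \<eta> (b y) \<ge> k} \<longleftrightarrow> y \<in> {y\<in>\<Omega>. a y / b y \<ge> k}"
        by eventually_elim simp
    qed
  qed (unfold sp[symmetric], measurable)
  from order_tendstoD(1)[OF this tail] small[OF \<psi>] show ?thesis
  proof eventually_elim
    case (elim \<eta>)
    thus ?case using k by (intro notin_surprise_region_if_tail_ge[where k = k]) auto
  qed
qed

text \<open>Think of \<open>D l\<close> as the limit in \<open>\<eta>\<close> of the region of the discretized problem with ratio \<open>R l\<close>,
  lower or upper. Only decisive levels, with content different from \<open>\<gamma>\<close>, are assumed to determine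
  membership in \<open>D l\<close>, since content exactly \<open>\<gamma>\<close> may fall short of \<open>\<gamma>\<close> after any truncation. If the
  tail at the own value of \<open>\<psi>\<close> is not \<open>\<gamma>\<close>, its continuity gives a decisive level strictly on one side
  of the value, and this level stays decisive for \<open>R l\<close>, by convergence of the ratio at \<open>\<psi>\<close> and of
  its tail.\<close>
lemma eventually_mem_iff_mem_surprise_region:
  assumes sp: "space P = \<Omega>" and fin: "finite_measure P"
    and r: "(\<lambda>y. p y / q y) \<in> borel_measurable P"
    and R: "\<And>l. l > 0 \<Longrightarrow> R l \<in> borel_measurable P"
    and lim: "AE y in P. ((\<lambda>l::real. R l y) \<longlongrightarrow> p y / q y) (at_right 0)"
    and atom: "\<And>t. measure P {y\<in>\<Omega>. p y / q y = t} = 0"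
    and \<psi>: "\<psi> \<in> \<Omega>" "((\<lambda>l. R l \<psi>) \<longlongrightarrow> p \<psi> / q \<psi>) (at_right 0)"
    and neq: "measure P {y\<in>\<Omega>. p y / q y \<ge> p \<psi> / q \<psi>} \<noteq> \<gamma>"
    and mem: "\<And>l k. l > 0 \<Longrightarrow> measure P {y\<in>\<Omega>. R l y \<ge> k} < \<gamma> \<Longrightarrow> k \<le> R l \<psi> \<Longrightarrow> \<psi> \<in> D l"
    and notin: "\<And>l k. l > 0 \<Longrightarrow> measure P {y\<in>\<Omega>. R l y \<ge> k} > \<gamma> \<Longrightarrow> k > R l \<psi> \<Longrightarrow> \<psi> \<notin> D l"
  shows "\<forall>\<^sub>F l in at_right 0. \<psi> \<in> D l \<longleftrightarrow> \<psi> \<in> surprise_region \<Omega> P p q \<gamma>"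
proof -
  interpret finite_measure P by fact
  have tails: "((\<lambda>l. measure P {y\<in>\<Omega>. R l y \<ge> k}) \<longlongrightarrow> measure P {y\<in>\<Omega>. p y / q y \<ge> k}) (at_right 0)" for k
    using tendsto_tail[OF r R lim] atom by (simp add: sp)
  note pos = eventually_at_right_less[of "0::real"]
  consider "measure P {y\<in>\<Omega>. p y / q y \<ge> p \<psi> / q \<psi>} < \<gamma>"
    | "measure P {y\<in>\<Omega>. p y / q y \<ge> p \<psi> / q \<psi>} > \<gamma>"
    using neq by linarith
  thus ?thesis
  proof cases
    case 1
    obtain k where k: "k < p \<psi> / q \<psi>" "measure P {y\<in>\<Omega>. p y / q y \<ge> k} < \<gamma>"
      using tail_less_below[OF r, of "p \<psi> / q \<psi>" \<gamma>] atom 1 by (auto simp: sp)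
    have in_r: "\<psi> \<in> surprise_region \<Omega> P p q \<gamma>"
      using k by (intro mem_surprise_region_if_tail_less[OF sp fin r \<psi>(1)]) auto
    from order_tendstoD(2)[OF tails k(2)] order_tendstoD(1)[OF \<psi>(2) k(1)] pos show ?thesis
      by eventually_elim (use mem in_r in \<open>auto intro: less_imp_le\<close>)
  next
    case 2
    obtain k where k: "k > p \<psi> / q \<psi>" "measure P {y\<in>\<Omega>. p y / q y \<ge> k} > \<gamma>"
      using tail_greater_above[OF r, of "p \<psi> / q \<psi>" \<gamma>] atom 2 by (auto simp: sp)
    have notin_r: "\<psi> \<notin> surprise_region \<Omega> P p q \<gamma>"
      using k by (intro notin_surprise_region_if_tail_ge[where k = k]) auto
    from order_tendstoD(1)[OF tails k(2)] order_tendstoD(2)[OF \<psi>(2) k(1)] pos show ?thesis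
      by eventually_elim (use notin notin_r in auto)
  qed
qed

section \<open>The posterior and the limit theorem\<close>

text \<open>Positivity of the evidence carries integrability, as the integral of a function that is not
  integrable is 0.\<close>
lemma prob_space_posterior:
  assumes "\<forall>\<theta>\<in>\<Theta>. \<pi> \<theta> * f \<theta> x \<ge> 0" and pos: "evidence \<Theta> \<pi> f x > 0"
  shows "prob_space (posterior \<Theta> \<pi> f x)"
proof (rule prob_spaceI)
  let ?m = "evidence \<Theta> \<pi> f x"
  have int: "integrable (vol \<Theta>) (\<lambda>\<theta>. \<pi> \<theta> * f \<theta> x)"
    using pos not_integrable_integral_eq unfolding evidence_def by fastforce
  hence int': "integrable (vol \<Theta>) (\<lambda>\<theta>. \<pi> \<theta> * f \<theta> x / ?m)" by simp
  have "emeasure (posterior \<Theta> \<pi> f x) (space (posterior \<Theta> \<pi> f x)) =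
      (\<integral>\<^sup>+\<theta>. ennreal (\<pi> \<theta> * f \<theta> x / ?m) \<partial>vol \<Theta>)"
    unfolding posterior_def using borel_measurable_integrable[OF int']
    by (subst emeasure_density) (auto intro!: nn_integral_cong simp: indicator_def)
  also have "\<dots> = ennreal (LINT \<theta>|vol \<Theta>. \<pi> \<theta> * f \<theta> x / ?m)"
    by (rule nn_integral_eq_integral[OF int'])
      (use assms in \<open>auto intro!: AE_I2 divide_nonneg_pos simp: space_restrict_space\<close>)
  also have "\<dots> = 1"
    using pos by (simp add: evidence_def)
  finally show "emeasure (posterior \<Theta> \<pi> f x) (space (posterior \<Theta> \<pi> f x)) = 1" .
qed

theorem theorem11:
  fixes \<Theta> :: "'a::euclidean_space set" and X :: "'x::euclidean_space set"
    and \<Omega> :: "'p::euclidean_space set"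
    and f :: "'a \<Rightarrow> 'x \<Rightarrow> real" and \<pi> :: "'a \<Rightarrow> real" and \<Psi> :: "'a \<Rightarrow> 'p"
    and q p :: "'p \<Rightarrow> real" and x :: 'x and \<gamma> :: real
    and B :: "real \<Rightarrow> 'p \<Rightarrow> 'p set" and s :: "real \<Rightarrow> 'p \<Rightarrow> 'p"
  assumes "open \<Theta>" "open X" "open \<Omega>"
    and "case_prod f \<in> borel_measurable (vol \<Theta> \<Otimes>\<^sub>M vol X)"
    and "\<forall>\<theta>\<in>\<Theta>. \<forall>y\<in>X. f \<theta> y \<ge> 0"
    and "\<forall>\<theta>\<in>\<Theta>. prob_space (density (vol X) (\<lambda>y. ennreal (f \<theta> y)))"
    and "\<pi> \<in> borel_measurable (vol \<Theta>)"
    and "\<forall>\<theta>\<in>\<Theta>. \<pi> \<theta> \<ge> 0"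
    and "prob_space (prior \<Theta> \<pi>)"
    and "x \<in> X" and "evidence \<Theta> \<pi> f x > 0"
    and "distributed (prior \<Theta> \<pi>) (vol \<Omega>) \<Psi> (\<lambda>\<psi>. ennreal (q \<psi>))"
    and "distributed (posterior \<Theta> \<pi> f x) (vol \<Omega>) \<Psi> (\<lambda>\<psi>. ennreal (p \<psi>))"
    and "\<forall>\<psi>\<in>\<Omega>. p \<psi> \<ge> 0"
    and "AE \<psi> in vol \<Omega>. isCont p \<psi>"
    and "\<forall>\<psi>\<in>\<Omega>. q \<psi> > 0" and "continuous_on \<Omega> q"
    and "regular_discretization \<Omega> (marginal (prior \<Theta> \<pi>) \<Psi> \<Omega>) q B"
    and "cell_representatives \<Omega> B s"
    and "\<forall>t. measure (marginal (posterior \<Theta> \<pi> f x) \<Psi> \<Omega>) {\<psi>\<in>\<Omega>. p \<psi> / q \<psi> = t} = 0"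
    and "0 \<le> \<gamma>" "\<gamma> \<le> 1"
    and "\<gamma> = 1 \<longrightarrow> (AE \<psi> in vol \<Omega>. p \<psi> > 0)"
  shows "set_lim0 (marginal (prior \<Theta> \<pi>) \<Psi> \<Omega>)
      (\<lambda>l. liminf0 (\<lambda>\<eta>. lpl_region \<Omega> (prior \<Theta> \<pi>) (posterior \<Theta> \<pi> f x) \<Psi> B s \<eta> l \<gamma>))
      (surprise_region \<Omega> (marginal (posterior \<Theta> \<pi> f x) \<Psi> \<Omega>) p q \<gamma>)
    \<and> set_lim0 (marginal (prior \<Theta> \<pi>) \<Psi> \<Omega>)
      (\<lambda>l. limsup0 (\<lambda>\<eta>. lpl_region \<Omega> (prior \<Theta> \<pi>) (posterior \<Theta> \<pi> f x) \<Psi> B s \<eta> l \<gamma>))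
      (surprise_region \<Omega> (marginal (posterior \<Theta> \<pi> f x) \<Psi> \<Omega>) p q \<gamma>)"
proof -
  define Q where "Q = marginal (prior \<Theta> \<pi>) \<Psi> \<Omega>"
  define P where "P = marginal (posterior \<Theta> \<pi> f x) \<Psi> \<Omega>"
  let ?V = "vol \<Omega>"
  have \<pi>f: "\<forall>\<theta>\<in>\<Theta>. \<pi> \<theta> * f \<theta> x \<ge> 0"
    using assms(5,8,10) by simp
  have post: "prob_space (posterior \<Theta> \<pi> f x)"
    by (rule prob_space_posterior[OF \<pi>f assms(11)])
  have \<Psi>_post: "\<Psi> \<in> measurable (posterior \<Theta> \<pi> f x) ?V"
    and p_ennreal: "(\<lambda>\<psi>. ennreal (p \<psi>)) \<in> borel_measurable ?V"
    and P_density: "P = density ?V (\<lambda>\<psi>. ennreal (p \<psi>))"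
    using assms(13) unfolding distributed_def P_def marginal_def by auto
  have \<Psi>_prior: "\<Psi> \<in> measurable (prior \<Theta> \<pi>) ?V"
    and q_ennreal: "(\<lambda>\<psi>. ennreal (q \<psi>)) \<in> borel_measurable ?V"
    and Q_density: "Q = density ?V (\<lambda>\<psi>. ennreal (q \<psi>))"
    using assms(12) unfolding distributed_def Q_def marginal_def by auto
  interpret P: prob_space P
    unfolding P_def marginal_def by (rule prob_space.prob_space_distr[OF post \<Psi>_post])
  interpret Q: prob_space Q
    unfolding Q_def marginal_def by (rule prob_space.prob_space_distr[OF assms(9) \<Psi>_prior])
  have space_V: "space ?V = \<Omega>" and space_P: "space P = \<Omega>"
    by (simp_all add: P_density space_restrict_space)
  have sets_P: "sets P = sets ?V" and sets_Q: "sets Q = sets ?V"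
    by (simp_all add: P_density Q_density)

  have real_measurable: "g \<in> borel_measurable ?V"
    if "(\<lambda>\<psi>. ennreal (g \<psi>)) \<in> borel_measurable ?V" "\<forall>\<psi>\<in>\<Omega>. g \<psi> \<ge> 0" for g :: "'p \<Rightarrow> real"
    using borel_measurable_enn2real[OF that(1)] that(2)
    by (subst measurable_cong[where g = "\<lambda>\<psi>. enn2real (ennreal (g \<psi>))"]) (auto simp: space_V)
  have r: "(\<lambda>\<psi>. p \<psi> / q \<psi>) \<in> borel_measurable P"
    using real_measurable[OF p_ennreal] real_measurable[OF q_ennreal] assms(14,16)
    by (simp add: less_imp_le measurable_cong_sets[OF sets_P refl])

  note disc = assms(18)[folded Q_def, unfolded regular_discretization_def]
  have cells: "cell_system \<Omega> (B l) (s l)" if "l > 0" for l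
  proof (rule cell_system.intro)
    show "countable (B l ` \<Omega>)" "partition_on \<Omega> (B l ` \<Omega>)" using disc that by blast+
    show "\<psi> \<in> B l \<psi> \<and> B l \<psi> \<in> sets ?V" if "\<psi> \<in> \<Omega>" for \<psi>
      using disc \<open>l > 0\<close> that unfolding sets_Q by blast
    show "s l \<psi> \<in> B l \<psi>" if "\<psi> \<in> \<Omega>" for \<psi>
      using assms(19) \<open>l > 0\<close> that unfolding cell_representatives_def by blast
    show "s l \<psi>' = s l \<psi>" if "\<psi> \<in> \<Omega>" "\<psi>' \<in> B l \<psi>" for \<psi> \<psi>'
      using assms(19) \<open>l > 0\<close> that unfolding cell_representatives_def by blast
  qed
  have B_pos: "measure Q (B l \<psi>) > 0" if "l > 0" "\<psi> \<in> \<Omega>" for l \<psi>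
    using disc that by blast
  define R where "R l \<psi> = measure P (B l \<psi>) / measure Q (B l \<psi>)" for l \<psi>
  have cell_meas: "(\<lambda>\<psi>. h (B l \<psi>) :: real) \<in> borel_measurable P" if "l > 0" for l h
    by (rule cell_system.measurable_cell_function[OF cells[OF that] sets_P])
  have R: "R l \<in> borel_measurable P" if "l > 0" for l
    unfolding R_def by (intro borel_measurable_divide cell_meas that)

  have R_lim: "((\<lambda>l. R l \<psi>) \<longlongrightarrow> p \<psi> / q \<psi>) (at_right 0)" if \<psi>: "\<psi> \<in> \<Omega>" "isCont p \<psi>" for \<psi>
  proof -
    have Q_lim: "((\<lambda>l. measure Q (B l \<psi>) / measure ?V (B l \<psi>)) \<longlongrightarrow> q \<psi>) (at_right 0)"
      using disc \<psi>(1) by blast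
    (* The quotient would be 0 for cells of volume 0 or infinity, but its limit is positive. *)
    have vol_pos: "\<forall>\<^sub>F l in at_right 0. measure ?V (B l \<psi>) > 0"
      using order_tendstoD(1)[OF Q_lim assms(16)[rule_format, OF \<psi>(1)]]
      by (rule eventually_mono) (auto simp: zero_less_divide_iff leD[OF measure_nonneg])
    have diam: "((\<lambda>l. ediam (B l \<psi>)) \<longlongrightarrow> 0) (at_right 0)"
      by (rule tendsto_sandwich[where f = "\<lambda>_. 0" and h = "\<lambda>l. SUP \<psi>\<in>\<Omega>. ediam (B l \<psi>)"])
        (use disc \<psi>(1) in \<open>auto intro!: always_eventually SUP_upper\<close>)
    have "\<forall>\<^sub>F l in at_right 0. B l \<psi> \<in> sets ?V \<and> \<psi> \<in> B l \<psi> \<and> measure ?V (B l \<psi>) > 0"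
      using vol_pos eventually_at_right_less[of "0::real"]
      by eventually_elim (use cell_system.cell[OF cells] \<psi>(1) in auto)
    from tendsto_density_average[OF p_ennreal _ \<psi>(2) this diam]
    have "((\<lambda>l. measure P (B l \<psi>) / measure ?V (B l \<psi>)) \<longlongrightarrow> p \<psi>) (at_right 0)"
      using assms(14) P.finite_measure_axioms by (simp add: space_V P_density)
    from tendsto_divide[OF this Q_lim]
    have "((\<lambda>l. (measure P (B l \<psi>) / measure ?V (B l \<psi>)) / (measure Q (B l \<psi>) / measure ?V (B l \<psi>)))
        \<longlongrightarrow> p \<psi> / q \<psi>) (at_right 0)"
      using assms(16) \<psi>(1) by force
    thus ?thesis
      by (rule Lim_transform_eventually)
        (use vol_pos in \<open>auto elim!: eventually_mono simp: R_def\<close>)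
  qed
  have atom: "measure P {\<psi>\<in>\<Omega>. p \<psi> / q \<psi> = t} = 0" for t
    using assms(20) by (simp add: P_def)
  have cont: "AE \<psi> in ?V. \<psi> \<in> \<Omega> \<and> isCont p \<psi>"
    using assms(15) AE_space[of ?V] by eventually_elim (simp add: space_V)
  hence R_lim_AE: "AE \<psi> in P. ((\<lambda>l. R l \<psi>) \<longlongrightarrow> p \<psi> / q \<psi>) (at_right 0)"
    unfolding P_density AE_density[OF p_ennreal] by eventually_elim (simp add: R_lim)

  (* Posterior-null sets are volume-null only where p is positive. Where p vanishes the ratio is 0,
     its tail is all of the space, and the exceptional level could only be 1. *)
  have generic: "AE \<psi> in ?V. measure P {y\<in>\<Omega>. p y / q y \<ge> p \<psi> / q \<psi>} \<noteq> \<gamma>"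
  proof -
    have "AE \<psi> in P. measure P {y\<in>\<Omega>. p y / q y \<ge> p \<psi> / q \<psi>} \<noteq> \<gamma>"
      using P.AE_tail_at_own_value_neq[OF r] atom by (simp add: space_P)
    hence "AE \<psi> in ?V. p \<psi> > 0 \<longrightarrow> measure P {y\<in>\<Omega>. p y / q y \<ge> p \<psi> / q \<psi>} \<noteq> \<gamma>"
      unfolding P_density AE_density[OF p_ennreal] by simp
    moreover have "AE \<psi> in ?V. p \<psi> > 0 \<or> \<gamma> < 1"
      using assms(22,23) by (cases "\<gamma> = 1") auto
    ultimately show ?thesis using cont
    proof eventually_elim
      case (elim \<psi>)
      show ?case
      proof (cases "p \<psi> > 0")
        case False
        have "{y\<in>\<Omega>. p y / q y \<ge> 0} = space P"
          using assms(14,16) by (auto simp: space_P less_imp_le)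
        moreover have "p \<psi> = 0" using False elim assms(14) by force
        ultimately show ?thesis using False elim P.prob_space by simp
      qed (use elim in simp)
    qed
  qed

  let ?S = "surprise_region \<Omega> P p q \<gamma>"
  let ?L = "\<lambda>l \<eta>. lpl_region \<Omega> (prior \<Theta> \<pi>) (posterior \<Theta> \<pi> f x) \<Psi> B s \<eta> l \<gamma>"
  have L_eq: "?L l \<eta> = surprise_region \<Omega> P (\<lambda>y. measure P (B l y)) (\<lambda>y. max \<eta> (measure Q (B l y))) \<gamma>"
    if "l > 0" "\<eta> > 0" for l \<eta>
    unfolding lpl_region_def P_def Q_def
    by (rule cell_system.undiscretize_disc_lpl_region[OF cells[OF that(1)] post \<Psi>_post assms(3) that(2)])
  have mem: "\<forall>\<^sub>F \<eta> in at_right 0. \<psi> \<in> ?L l \<eta>"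
    if "l > 0" "\<psi> \<in> \<Omega>" "measure P {y\<in>\<Omega>. R l y \<ge> k} < \<gamma>" "k \<le> R l \<psi>" for l k \<psi>
  proof -
    have "\<forall>\<^sub>F \<eta> in at_right 0. \<psi> \<in> surprise_region \<Omega> P (\<lambda>y. measure P (B l y)) (\<lambda>y. max \<eta> (measure Q (B l y))) \<gamma>"
      by (rule eventually_mem_surprise_region_truncated[OF space_P P.finite_measure_axioms])
        (use that cell_meas B_pos in \<open>auto simp: R_def\<close>)
    with eventually_at_right_less[of "0::real"] show ?thesis
      by eventually_elim (simp add: L_eq that(1))
  qed
  have notin: "\<forall>\<^sub>F \<eta> in at_right 0. \<psi> \<notin> ?L l \<eta>"
    if "l > 0" "\<psi> \<in> \<Omega>" "measure P {y\<in>\<Omega>. R l y \<ge> k} > \<gamma>" "k > R l \<psi>" for l k \<psi>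
  proof -
    have "\<forall>\<^sub>F \<eta> in at_right 0. \<psi> \<notin> surprise_region \<Omega> P (\<lambda>y. measure P (B l y)) (\<lambda>y. max \<eta> (measure Q (B l y))) \<gamma>"
      by (rule eventually_notin_surprise_region_truncated[OF space_P P.finite_measure_axioms])
        (use that cell_meas B_pos in \<open>auto simp: R_def\<close>)
    with eventually_at_right_less[of "0::real"] show ?thesis
      by eventually_elim (simp add: L_eq that(1))
  qed

  (* D stands for the lower or the upper limit in \<eta>. At almost every point the regions eventually
     agree on membership, and then both limits give the same answer. *)
  have main: "set_lim0 Q D ?S"
    if D: "\<And>l \<psi>. \<forall>\<^sub>F \<eta> in at_right 0. \<psi> \<in> ?L l \<eta> \<Longrightarrow> \<psi> \<in> D l"
      "\<And>l \<psi>. \<forall>\<^sub>F \<eta> in at_right 0. \<psi> \<notin> ?L l \<eta> \<Longrightarrow> \<psi> \<notin> D l" for D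
  proof (rule set_lim0_if_AE_eventually)
    have "AE \<psi> in ?V. \<forall>\<^sub>F l in at_right 0. \<psi> \<in> D l \<longleftrightarrow> \<psi> \<in> ?S"
      using cont generic
    proof eventually_elim
      case (elim \<psi>)
      show ?case
      proof (rule eventually_mem_iff_mem_surprise_region[OF space_P P.finite_measure_axioms r R R_lim_AE atom])
        show "\<psi> \<in> \<Omega>" "((\<lambda>l. R l \<psi>) \<longlongrightarrow> p \<psi> / q \<psi>) (at_right 0)"
          "measure P {y\<in>\<Omega>. p y / q y \<ge> p \<psi> / q \<psi>} \<noteq> \<gamma>"
          using elim R_lim by auto
      qed (use elim D mem notin in blast)+
    qed
    thus "AE \<psi> in Q. \<forall>\<^sub>F l in at_right 0. \<psi> \<in> D l \<longleftrightarrow> \<psi> \<in> ?S"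
      unfolding Q_density AE_density[OF q_ennreal] by eventually_elim simp
  qed
  have "set_lim0 Q (\<lambda>l. liminf0 (?L l)) ?S"
  proof (rule main)
    show "\<psi> \<notin> liminf0 (?L l)" if "\<forall>\<^sub>F \<eta> in at_right 0. \<psi> \<notin> ?L l \<eta>" for l \<psi>
      using that eventually_frequently[OF trivial_limit_at_right_real]
      by (auto simp: mem_liminf0_iff frequently_def)
  qed (simp add: mem_liminf0_iff)
  moreover have "set_lim0 Q (\<lambda>l. limsup0 (?L l)) ?S"
  proof (rule main)
    show "\<psi> \<in> limsup0 (?L l)" if "\<forall>\<^sub>F \<eta> in at_right 0. \<psi> \<in> ?L l \<eta>" for l \<psi>
      using eventually_frequently[OF trivial_limit_at_right_real that] by (simp add: mem_limsup0_iff)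
  qed (simp add: mem_limsup0_iff frequently_def)
  ultimately show ?thesis unfolding Q_def P_def by blast
qed

end
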